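(* Let $n\ge 1$, let $A$ be a proper $n\times n$ alternating sign matrix (ASM), and let $Q=Q(A)$ be the corresponding discrete quasi-copula on $L_n^2$. Then each of the six functions $Q_{\searrow},Q_{\swarrow},Q_{\nwarrow},Q_{\nearrow},Q_M,Q_O$ is a discrete quasi-copula on $L_n^2$, and the alternating bistochastic matrix (ABM) corresponding to it is an ASM.
   Context: Let $L_n=\{0,1,\dots,n\}$. A discrete quasi-copula on $L_n^2$ is a function $Q:L_n^2\to[0,n]$ such that (i) $Q(r,0)=Q(0,s)=0$, $Q(r,n)=r$, $Q(n,s)=s$ for all $r,s\in L_n$; and (ii) $Q(x_1,y_1)+Q(x_2,y_2)\ge Q(x_1,y_2)+Q(x_2,y_1)$ for all $x_1\le x_2$, $y_1\le y_2$ in $L_n$ such that at least one of $x_1,x_2,y_1,y_2$ equals $0$ or $n$. An alternating bistochastic matrix (ABM) is a real $n\times n$ matrix $A=(a_{ij})$ such that for all $i,j\in\{1,\dots,n\}$: $0\le\sum_{s=1}^{i}a_{sj}\le 1$, $0\le\sum_{r=1}^{j}a_{ir}\le 1$, $\sum_{s=1}^n a_{sj}=1$, $\sum_{r=1}^n a_{ir}=1$. An alternating sign matrix (ASM) is an ABM with all entries in $\{-1,0,1\}$ (so in each row and column the nonzero entries alternate in sign and sum to $1$). An ASM is proper if it has at least one entry equal to $-1$. Discrete quasi-copulas on $L_n^2$ and $n\times n$ ABMs are in bijective correspondence: to an ABM $A$ corresponds $Q(A)$ given by $Q(A)(r,0)=Q(A)(0,s)=0$ and $Q(A)(r,s)=\sum_{i=1}^r\sum_{j=1}^s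 a_{ij}$ for $r,s\ge1$; conversely, to $Q$ corresponds the ABM $A(Q)=(a_{st})_{s,t=1}^n$ with $a_{st}=Q(s,t)+Q(s-1,t-1)-Q(s,t-1)-Q(s-1,t)$. For a rectangle $R=[i,j]\times[k,l]$ with $0\le i\le j\le n$, $0\le k\le l\le n$ (where $[i,j]=\{i,i+1,\dots,j\}$) the $Q$-volume is $V_Q(R)=Q(i,k)+Q(j,l)-Q(i,l)-Q(j,k)$. For $(r,s)\in L_n^2$ put $\mathcal R_{\searrow}(r,s)=\{[r,r+i]\times[s,s+j]: 1\le i\le n-r,\ 1\le j\le n-s\}$, $\mathcal R_{\swarrow}(r,s)=\{[r,r+i]\times[j,s]: 1\le i\le n-r,\ 1\le j\le s\}$, $\mathcal R_{\nwarrow}(r,s)=\{[i,r]\times[j,s]: 1\le i\le r,\ 1\le j\le s\}$, $\mathcal R_{\nearrow}(r,s)=\{[i,r]\times[s,s+j]: 1\le i\le r,\ 1\le j\le n-s\}$. For each direction $*\in\{\searrow,\swarrow,\nwarrow,\nearrow\}$ the directional defect is the function $D_*^Q$ on $L_n^2$ given by $D_*^Q(r,s)=\min\big(\{0\}\cup\{V_Q(R): R\in\mathcal R_*(r,s)\}\big)$. The main and opposite defects are $D_M^Q(r,s)=\min\{D_{\searrow}^Q(r,s),D_{\nwarrow}^Q(r,s)\}$ and $D_O^Q(r,s)=\min\{D_{\swarrow}^Q(r,s),D_{\nearrow}^Q(r,s)\}$. The six defect transformations of $Q$ are $Q_{\searrow}=Q-D^Q_{\searrow}$, $Q_{\swarrow}=Q+D^Q_{\swarrow}$,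 $Q_{\nwarrow}=Q-D^Q_{\nwarrow}$, $Q_{\nearrow}=Q+D^Q_{\nearrow}$, $Q_M=Q-D^Q_M$, $Q_O=Q+D^Q_O$. *)

theory Defs
  imports Complex_Main
begin

text \<open>
  Real \<open>n \<times> n\<close> matrices are functions \<open>A :: nat \<Rightarrow> nat \<Rightarrow> real\<close> whose entries \<open>A i j\<close> matter
  only for \<open>i, j \<in> {1..n}\<close>. Functions on \<open>L\<^sub>n \<times> L\<^sub>n\<close>, where \<open>L\<^sub>n = {0..n}\<close>, are functions
  \<open>Q :: nat \<Rightarrow> nat \<Rightarrow> real\<close> whose values \<open>Q r s\<close> matter only for \<open>r, s \<in> {0..n}\<close>.
\<close>

definition discrete_quasi_copula :: "nat \<Rightarrow> (nat \<Rightarrow> nat \<Rightarrow> real) \<Rightarrow> bool" where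
  "discrete_quasi_copula n Q \<longleftrightarrow>
     (\<forall>r\<in>{0..n}. \<forall>s\<in>{0..n}. 0 \<le> Q r s \<and> Q r s \<le> real n) \<and>
     (\<forall>r\<in>{0..n}. Q r 0 = 0 \<and> Q r n = real r) \<and>
     (\<forall>s\<in>{0..n}. Q 0 s = 0 \<and> Q n s = real s) \<and>
     (\<forall>x1\<in>{0..n}. \<forall>x2\<in>{0..n}. \<forall>y1\<in>{0..n}. \<forall>y2\<in>{0..n}.
        x1 \<le> x2 \<longrightarrow> y1 \<le> y2 \<longrightarrow> (\<exists>z\<in>{x1, x2, y1, y2}. z = 0 \<or> z = n) \<longrightarrow>
        Q x1 y1 + Q x2 y2 \<ge> Q x1 y2 + Q x2 y1)"

definition abm :: "nat \<Rightarrow> (nat \<Rightarrow> nat \<Rightarrow> real) \<Rightarrow> bool" where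
  "abm n A \<longleftrightarrow>
     (\<forall>i\<in>{1..n}. \<forall>j\<in>{1..n}.
        0 \<le> (\<Sum>s=1..i. A s j) \<and> (\<Sum>s=1..i. A s j) \<le> 1 \<and>
        0 \<le> (\<Sum>r=1..j. A i r) \<and> (\<Sum>r=1..j. A i r) \<le> 1 \<and>
        (\<Sum>s=1..n. A s j) = 1 \<and> (\<Sum>r=1..n. A i r) = 1)"

definition asm :: "nat \<Rightarrow> (nat \<Rightarrow> nat \<Rightarrow> real) \<Rightarrow> bool" where
  "asm n A \<longleftrightarrow> abm n A \<and> (\<forall>i\<in>{1..n}. \<forall>j\<in>{1..n}. A i j \<in> {-1, 0, 1})"

definition proper_asm :: "nat \<Rightarrow> (nat \<Rightarrow> nat \<Rightarrow> real) \<Rightarrow> bool" where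
  "proper_asm n A \<longleftrightarrow> asm n A \<and> (\<exists>i\<in>{1..n}. \<exists>j\<in>{1..n}. A i j = -1)"

text \<open>The boundary values at \<open>r = 0\<close> or \<open>s = 0\<close> are \<open>0\<close> because the sum is then empty.\<close>

definition quasi_copula_of :: "(nat \<Rightarrow> nat \<Rightarrow> real) \<Rightarrow> nat \<Rightarrow> nat \<Rightarrow> real" where
  "quasi_copula_of A r s = (\<Sum>i=1..r. \<Sum>j=1..s. A i j)"

text \<open>Only indices \<open>s, t \<in> {1..n}\<close> are relevant, so the subtraction never truncates.\<close>

definition abm_of :: "(nat \<Rightarrow> nat \<Rightarrow> real) \<Rightarrow> nat \<Rightarrow> nat \<Rightarrow> real" where
  "abm_of Q s t = Q s t + Q (s - 1) (t - 1) - Q s (t - 1) - Q (s - 1) t"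

text \<open>\<open>Rect i j k l\<close> stands for the discrete rectangle \<open>{i..j} \<times> {k..l}\<close>, with \<open>i \<le> j\<close> and \<open>k \<le> l\<close>;
  being nonempty, it is determined by these endpoints.\<close>

datatype rectangle = Rect nat nat nat nat

fun volume :: "(nat \<Rightarrow> nat \<Rightarrow> real) \<Rightarrow> rectangle \<Rightarrow> real" where
  "volume Q (Rect i j k l) = Q i k + Q j l - Q i l - Q j k"

text \<open>The directions are those of the arrows in matrix coordinates: the first coordinate grows
  to the south, the second one to the east.\<close>

datatype direction = SE | SW | NW | NE

fun rectangles :: "nat \<Rightarrow> direction \<Rightarrow> nat \<Rightarrow> nat \<Rightarrow> rectangle set" where
  "rectangles n SE r s = {Rect r (r + i) s (s + j) | i j. i \<in> {1..n - r} \<and> j \<in> {1..n - s}}"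
| "rectangles n SW r s = {Rect r (r + i) j s | i j. i \<in> {1..n - r} \<and> j \<in> {1..s}}"
| "rectangles n NW r s = {Rect i r j s | i j. i \<in> {1..r} \<and> j \<in> {1..s}}"
| "rectangles n NE r s = {Rect i r s (s + j) | i j. i \<in> {1..r} \<and> j \<in> {1..n - s}}"

definition defect :: "nat \<Rightarrow> direction \<Rightarrow> (nat \<Rightarrow> nat \<Rightarrow> real) \<Rightarrow> nat \<Rightarrow> nat \<Rightarrow> real" where
  "defect n d Q r s = Min ({0} \<union> volume Q ` rectangles n d r s)"

definition main_defect :: "nat \<Rightarrow> (nat \<Rightarrow> nat \<Rightarrow> real) \<Rightarrow> nat \<Rightarrow> nat \<Rightarrow> real" where
  "main_defect n Q r s = min (defect n SE Q r s) (defect n NW Q r s)"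

definition opposite_defect :: "nat \<Rightarrow> (nat \<Rightarrow> nat \<Rightarrow> real) \<Rightarrow> nat \<Rightarrow> nat \<Rightarrow> real" where
  "opposite_defect n Q r s = min (defect n SW Q r s) (defect n NE Q r s)"

fun directional_transform ::
  "nat \<Rightarrow> direction \<Rightarrow> (nat \<Rightarrow> nat \<Rightarrow> real) \<Rightarrow> nat \<Rightarrow> nat \<Rightarrow> real" where
  "directional_transform n SE Q r s = Q r s - defect n SE Q r s"
| "directional_transform n SW Q r s = Q r s + defect n SW Q r s"
| "directional_transform n NW Q r s = Q r s - defect n NW Q r s"
| "directional_transform n NE Q r s = Q r s + defect n NE Q r s"

definition main_transform :: "nat \<Rightarrow> (nat \<Rightarrow> nat \<Rightarrow> real) \<Rightarrow> nat \<Rightarrow> nat \<Rightarrow> real" where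
  "main_transform n Q r s = Q r s - main_defect n Q r s"

definition opposite_transform :: "nat \<Rightarrow> (nat \<Rightarrow> nat \<Rightarrow> real) \<Rightarrow> nat \<Rightarrow> nat \<Rightarrow> real" where
  "opposite_transform n Q r s = Q r s + opposite_defect n Q r s"

lemma finite_rectangles: "finite (rectangles n d r s)"
  by (cases d; simp only: rectangles.simps; intro finite_image_set2; simp)

end

theory Submission
  imports Defs
begin

text \<open>
  A function \<open>Q\<close> on the grid is a discrete quasi-copula exactly when it has the right values on the
  boundary and grows by an amount in \<open>[0, 1]\<close> along every edge of the grid. If moreover \<open>Q\<close> is
  integer valued, then all these increments are \<open>0\<close> or \<open>1\<close>, and each entry of \<open>abm_of Q\<close>, being a
  difference of two of them, lies in \<open>{-1, 0, 1}\<close>. So alternating sign matrices correspond to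
  integer valued quasi-copulas, and it suffices that the six transformations preserve the latter.

  The volume of a rectangle with corner \<open>(r, s)\<close> and opposite corner \<open>(i, j)\<close> is, up to sign, the
  difference between \<open>Q r s\<close> and the exchange value \<open>Q r j + Q i s - Q i j\<close>. Adding or subtracting
  the defect therefore turns \<open>Q r s\<close> into the maximum (for \<open>SE\<close> and \<open>NW\<close>) or the minimum (for \<open>SW\<close>
  and \<open>NE\<close>) of the exchange values over the \<open>(i, j)\<close> in a quadrant at \<open>(r, s)\<close>; the value \<open>0\<close> in
  the definition of the defect accounts for the degenerate cases \<open>i = r\<close> and \<open>j = s\<close>. This extremum
  is an integer if \<open>Q\<close> is integer valued.

  For a step from \<open>r\<close> to \<open>r + 1\<close>, a pair \<open>(i, j)\<close> in both quadrants changes its exchange value by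
  \<open>Q (r + 1) j - Q r j\<close>, which lies in \<open>[0, 1]\<close>; the pairs in only one of the quadrants have \<open>i\<close> equal
  to the row of its corner, so their exchange value is just the value of \<open>Q\<close> at that corner. Hence
  the two sets of exchange values can be matched, in both directions, with increments in \<open>[0, 1]\<close>, and
  their maxima and minima inherit this bound. On the boundary of the grid all volumes in question
  are nonnegative, so that the defects vanish there and the boundary values stay. Finally, the main and
  opposite transformations are the pointwise maximum and minimum of two directional ones.
\<close>

section \<open>Quasi-copulas as functions with unit steps\<close>

definition unit_step :: "real \<Rightarrow> real \<Rightarrow> bool" where
  "unit_step x y \<longleftrightarrow> x \<le> y \<and> y \<le> x + 1"

lemma unit_step_max: "unit_step a b \<Longrightarrow> unit_step c d \<Longrightarrow> unit_step (max a c) (max b d)"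
  and unit_step_min: "unit_step a b \<Longrightarrow> unit_step c d \<Longrightarrow> unit_step (min a c) (min b d)"
  by (auto simp: unit_step_def)

lemma unit_steps_bounds:
  fixes f :: "nat \<Rightarrow> real"
  assumes "\<And>k. k < n \<Longrightarrow> unit_step (f k) (f (Suc k))" and "a \<le> b" and "b \<le> n"
  shows "f a \<le> f b" and "f b \<le> f a + (real b - real a)"
proof -
  have "f a \<le> f b \<and> f b \<le> f a + (real b - real a)"
    using assms(2,3)
  proof (induction b rule: dec_induct)
    case (step k)
    then show ?case using assms(1)[of k] by (auto simp: unit_step_def)
  qed simp
  then show "f a \<le> f b" and "f b \<le> f a + (real b - real a)" by auto
qed

lemma quasi_copula_boundary:
  assumes "discrete_quasi_copula n Q" and "k \<le> n"
  shows "Q k 0 = 0" "Q 0 k = 0" "Q k n = real k" "Q n k = real k"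
  using assms by (auto simp: discrete_quasi_copula_def)

lemma quasi_copula_boundary_volume:
  assumes "discrete_quasi_copula n Q" and "i \<le> j" "j \<le> n" "k \<le> l" "l \<le> n"
    and "i = 0 \<or> j = 0 \<or> k = 0 \<or> l = 0 \<or> i = n \<or> j = n \<or> k = n \<or> l = n"
  shows "volume Q (Rect i j k l) \<ge> 0"
proof -
  have "i \<in> {0..n}" "j \<in> {0..n}" "k \<in> {0..n}" "l \<in> {0..n}" using assms by auto
  moreover have "\<exists>z\<in>{i, j, k, l}. z = 0 \<or> z = n" using assms(6) by auto
  ultimately have "Q i k + Q j l \<ge> Q i l + Q j k"
    using assms(1,2,4) unfolding discrete_quasi_copula_def by blast
  then show ?thesis by simp
qed

text \<open>A step is the volume of a rectangle that touches the boundary: reaching down to \<open>0\<close> this gives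
  monotonicity, and reaching up to \<open>n\<close> it bounds the growth by \<open>1\<close>.\<close>

lemma quasi_copula_steps:
  assumes "discrete_quasi_copula n Q" and "r < n" and "s \<le> n"
  shows "unit_step (Q r s) (Q (Suc r) s)" and "unit_step (Q s r) (Q s (Suc r))"
proof -
  note b = quasi_copula_boundary[OF assms(1)]
  note v = quasi_copula_boundary_volume[OF assms(1)]
  show "unit_step (Q r s) (Q (Suc r) s)"
    using v[of r "Suc r" 0 s] v[of r "Suc r" s n] b[of r] b[of "Suc r"] assms(2,3)
    by (auto simp: unit_step_def)
  show "unit_step (Q s r) (Q s (Suc r))"
    using v[of 0 s r "Suc r"] v[of s n r "Suc r"] b[of r] b[of "Suc r"] assms(2,3)
    by (auto simp: unit_step_def)
qed

lemma quasi_copulaI: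
  assumes boundary: "\<And>k. k \<le> n \<Longrightarrow> Q k 0 = 0 \<and> Q 0 k = 0 \<and> Q k n = real k \<and> Q n k = real k"
    and row: "\<And>r s. r < n \<Longrightarrow> s \<le> n \<Longrightarrow> unit_step (Q r s) (Q (Suc r) s)"
    and col: "\<And>r s. r < n \<Longrightarrow> s \<le> n \<Longrightarrow> unit_step (Q s r) (Q s (Suc r))"
  shows "discrete_quasi_copula n Q"
proof -
  have R: "Q a s \<le> Q b s" "Q b s \<le> Q a s + (real b - real a)" if "a \<le> b" "b \<le> n" "s \<le> n" for a b s
    using unit_steps_bounds[of n "\<lambda>k. Q k s" a b] row that by auto
  have C: "Q s a \<le> Q s b" "Q s b \<le> Q s a + (real b - real a)" if "a \<le> b" "b \<le> n" "s \<le> n" for a b s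
    using unit_steps_bounds[of n "\<lambda>k. Q s k" a b] col that by auto
  have range: "0 \<le> Q r s \<and> Q r s \<le> real n" if "r \<le> n" "s \<le> n" for r s
    using R(1)[of 0 r s] R(1)[of r n s] boundary[of s] that by auto
  have volume: "Q x1 y1 + Q x2 y2 \<ge> Q x1 y2 + Q x2 y1"
    if le: "x1 \<le> x2" "y1 \<le> y2" "x2 \<le> n" "y2 \<le> n"
      and touch: "\<exists>z\<in>{x1, x2, y1, y2}. z = 0 \<or> z = n" for x1 x2 y1 y2
  proof -
    consider "x1 = 0" | "x2 = n" | "y1 = 0" | "y2 = n" using touch le by auto
    then show ?thesis
    proof cases
      case 1
      then show ?thesis using C(1)[of y1 y2 x2] boundary[of y1] boundary[of y2] le by auto
    next
      case 2
      then show ?thesis using C(2)[of y1 y2 x1] boundary[of y1] boundary[of y2] le by auto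
    next
      case 3
      then show ?thesis using R(1)[of x1 x2 y2] boundary[of x1] boundary[of x2] le by auto
    next
      case 4
      then show ?thesis using R(2)[of x1 x2 y1] boundary[of x1] boundary[of x2] le by auto
    qed
  qed
  show ?thesis
    unfolding discrete_quasi_copula_def using range boundary volume by simp
qed

section \<open>Alternating sign matrices and integer valued quasi-copulas\<close>

definition integral_quasi_copula :: "nat \<Rightarrow> (nat \<Rightarrow> nat \<Rightarrow> real) \<Rightarrow> bool" where
  "integral_quasi_copula n Q \<longleftrightarrow>
     discrete_quasi_copula n Q \<and> (\<forall>r\<le>n. \<forall>s\<le>n. Q r s \<in> \<int>)"

lemma quasi_copula_of_Suc_row:
  "quasi_copula_of A (Suc r) s = quasi_copula_of A r s + (\<Sum>j=1..s. A (Suc r) j)"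
  by (simp add: quasi_copula_of_def)

lemma quasi_copula_of_Suc_col:
  "quasi_copula_of A r (Suc s) = quasi_copula_of A r s + (\<Sum>i=1..r. A i (Suc s))"
  by (simp add: quasi_copula_of_def sum.distrib)

lemma integral_quasi_copula_of_asm:
  assumes "asm n A"
  shows "integral_quasi_copula n (quasi_copula_of A)"
proof -
  have partial: "0 \<le> (\<Sum>s=1..i. A s j)" "(\<Sum>s=1..i. A s j) \<le> 1"
      "0 \<le> (\<Sum>r=1..j. A i r)" "(\<Sum>r=1..j. A i r) \<le> 1"
      "(\<Sum>s=1..n. A s j) = 1" "(\<Sum>r=1..n. A i r) = 1" if "i \<in> {1..n}" "j \<in> {1..n}" for i j
    using assms that unfolding asm_def abm_def by blast+
  have total: "(\<Sum>s=1..n. A s k) = 1" "(\<Sum>r=1..n. A k r) = 1" if "k \<in> {1..n}" for k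
    using partial(5,6)[OF that that] .
  have "discrete_quasi_copula n (quasi_copula_of A)"
  proof (rule quasi_copulaI)
    fix k assume "k \<le> n"
    have "quasi_copula_of A k n = (\<Sum>i=1..k. 1)"
      unfolding quasi_copula_of_def using total(2) \<open>k \<le> n\<close> by (intro sum.cong refl) simp
    moreover have "quasi_copula_of A n k = (\<Sum>j=1..k. \<Sum>i=1..n. A i j)"
      unfolding quasi_copula_of_def by (rule sum.swap)
    moreover have "\<dots> = (\<Sum>j=1..k. 1)"
      using total(1) \<open>k \<le> n\<close> by (intro sum.cong refl) simp
    ultimately show "quasi_copula_of A k 0 = 0 \<and> quasi_copula_of A 0 k = 0 \<and>
        quasi_copula_of A k n = real k \<and> quasi_copula_of A n k = real k"
      by (simp add: quasi_copula_of_def)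
  next
    fix r s assume "r < n" "s \<le> n"
    then show "unit_step (quasi_copula_of A r s) (quasi_copula_of A (Suc r) s)"
      using partial(3,4)[of "Suc r" s]
      by (cases "s = 0") (auto simp: unit_step_def quasi_copula_of_Suc_row)
  next
    fix r s assume "r < n" "s \<le> n"
    then show "unit_step (quasi_copula_of A s r) (quasi_copula_of A s (Suc r))"
      using partial(1,2)[of s "Suc r"]
      by (cases "s = 0") (auto simp: unit_step_def quasi_copula_of_Suc_col)
  qed
  moreover have "quasi_copula_of A r s \<in> \<int>" if "r \<le> n" "s \<le> n" for r s
    unfolding quasi_copula_of_def
  proof (intro Ints_sum)
    fix i j assume "i \<in> {1..r}" "j \<in> {1..s}"
    then have "A i j \<in> {-1, 0, 1}" using assms that by (auto simp: asm_def)
    then show "A i j \<in> \<int>" by auto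
  qed
  ultimately show ?thesis by (simp add: integral_quasi_copula_def)
qed

lemma sum_abm_of_col:
  assumes "j \<ge> 1"
  shows "(\<Sum>s=1..i. abm_of Q s j) = Q i j - Q i (j - 1) - (Q 0 j - Q 0 (j - 1))"
  by (induction i) (auto simp: abm_of_def)

lemma sum_abm_of_row:
  assumes "i \<ge> 1"
  shows "(\<Sum>r=1..j. abm_of Q i r) = Q i j - Q (i - 1) j - (Q i 0 - Q (i - 1) 0)"
  by (induction j) (auto simp: abm_of_def)

lemma asm_abm_of:
  assumes "integral_quasi_copula n Q"
  shows "asm n (abm_of Q)"
proof -
  from assms have qc: "discrete_quasi_copula n Q"
    and int: "\<And>r s. r \<le> n \<Longrightarrow> s \<le> n \<Longrightarrow> Q r s \<in> \<int>"
    by (auto simp: integral_quasi_copula_def)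
  note b = quasi_copula_boundary[OF qc]
  have row: "unit_step (Q (i - 1) s) (Q i s)" and col: "unit_step (Q s (i - 1)) (Q s i)"
    if "i \<in> {1..n}" "s \<le> n" for i s
    using quasi_copula_steps[OF qc, of "i - 1" s] that by auto
  have "abm n (abm_of Q)"
    unfolding abm_def
  proof (intro ballI)
    fix i j assume ij: "i \<in> {1..n}" "j \<in> {1..n}"
    then have "i - 1 \<le> n" "j - 1 \<le> n" by auto
    with ij show "0 \<le> (\<Sum>s=1..i. abm_of Q s j) \<and> (\<Sum>s=1..i. abm_of Q s j) \<le> 1 \<and>
        0 \<le> (\<Sum>r=1..j. abm_of Q i r) \<and> (\<Sum>r=1..j. abm_of Q i r) \<le> 1 \<and>
        (\<Sum>s=1..n. abm_of Q s j) = 1 \<and> (\<Sum>r=1..n. abm_of Q i r) = 1"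
      using row[of i j] col[of j i] b[of i] b[of "i - 1"] b[of j] b[of "j - 1"]
        sum_abm_of_col[of j Q i] sum_abm_of_col[of j Q n]
        sum_abm_of_row[of i Q j] sum_abm_of_row[of i Q n]
      by (auto simp: unit_step_def)
  qed
  moreover have "abm_of Q i j \<in> {-1, 0, 1}" if ij: "i \<in> {1..n}" "j \<in> {1..n}" for i j
  proof -
    have "j - 1 \<le> n" using ij by auto
    have "abm_of Q i j \<in> \<int>"
      unfolding abm_of_def using ij by (intro Ints_add Ints_diff int) auto
    then obtain z where z: "abm_of Q i j = of_int z" by (auto elim: Ints_cases)
    have "\<bar>abm_of Q i j\<bar> \<le> 1"
      using row[OF ij(1), of j] row[OF ij(1), of "j - 1"] \<open>j - 1 \<le> n\<close> ij(2)
      unfolding unit_step_def abm_of_def atLeastAtMost_iff by linarith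
    then have "z \<in> {-1, 0, 1}" using z by auto
    then show ?thesis using z by auto
  qed
  ultimately show ?thesis by (simp add: asm_def)
qed

lemma integral_quasi_copula_max:
  assumes "integral_quasi_copula n P" and "integral_quasi_copula n Q"
  shows "integral_quasi_copula n (\<lambda>r s. max (P r s) (Q r s))"
proof -
  from assms have qc: "discrete_quasi_copula n P" "discrete_quasi_copula n Q"
    by (simp_all add: integral_quasi_copula_def)
  have "discrete_quasi_copula n (\<lambda>r s. max (P r s) (Q r s))"
    by (rule quasi_copulaI)
      (use quasi_copula_boundary[OF qc(1)] quasi_copula_boundary[OF qc(2)] in
        \<open>auto intro!: unit_step_max quasi_copula_steps[OF qc(1)] quasi_copula_steps[OF qc(2)]\<close>)
  then show ?thesis using assms by (simp add: integral_quasi_copula_def max_def)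
qed

lemma integral_quasi_copula_min:
  assumes "integral_quasi_copula n P" and "integral_quasi_copula n Q"
  shows "integral_quasi_copula n (\<lambda>r s. min (P r s) (Q r s))"
proof -
  from assms have qc: "discrete_quasi_copula n P" "discrete_quasi_copula n Q"
    by (simp_all add: integral_quasi_copula_def)
  have "discrete_quasi_copula n (\<lambda>r s. min (P r s) (Q r s))"
    by (rule quasi_copulaI)
      (use quasi_copula_boundary[OF qc(1)] quasi_copula_boundary[OF qc(2)] in
        \<open>auto intro!: unit_step_min quasi_copula_steps[OF qc(1)] quasi_copula_steps[OF qc(2)]\<close>)
  then show ?thesis using assms by (simp add: integral_quasi_copula_def min_def)
qed

section \<open>Exchange values\<close>

definition exchange_values ::
  "(nat \<Rightarrow> nat \<Rightarrow> real) \<Rightarrow> nat \<Rightarrow> nat \<Rightarrow> nat set \<Rightarrow> nat set \<Rightarrow> real set" where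
  "exchange_values Q r s I J = (\<lambda>(i, j). Q r j + Q i s - Q i j) ` (I \<times> J)"

lemma exchange_valuesE:
  assumes "x \<in> exchange_values Q r s I J"
  obtains i j where "i \<in> I" "j \<in> J" "x = Q r j + Q i s - Q i j"
  using assms by (auto simp: exchange_values_def)

lemma exchange_values_transpose:
  "exchange_values Q r s I J = exchange_values (\<lambda>a b. Q b a) s r J I"
  by (force simp: exchange_values_def image_iff)

lemma exchange_value_at_corner: "r \<in> I \<Longrightarrow> s \<in> J \<Longrightarrow> Q r s \<in> exchange_values Q r s I J"
  unfolding exchange_values_def by (rule image_eqI[of _ _ "(r, s)"]) auto

text \<open>Rows common to \<open>I\<close> and \<open>I'\<close> are matched with themselves. A row of only one of the sets is
  the row of its corner, where the exchange value is the value of \<open>Q\<close> at the corner, so that it can be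
  matched with the other corner.\<close>

lemma exchange_values_step:
  assumes step: "\<And>j. j \<in> J \<Longrightarrow> unit_step (Q r j) (Q r' j)"
    and "s \<in> J" "r \<in> I" "r' \<in> I'" and "I \<subseteq> insert r I'" "I' \<subseteq> insert r' I"
  shows "rel_set unit_step (exchange_values Q r s I J) (exchange_values Q r' s I' J)"
proof (rule rel_setI)
  fix x assume "x \<in> exchange_values Q r s I J"
  then obtain i j where ij: "i \<in> I" "j \<in> J" "x = Q r j + Q i s - Q i j"
    by (rule exchange_valuesE)
  show "\<exists>y\<in>exchange_values Q r' s I' J. unit_step x y"
  proof (cases "i \<in> I'")
    case True
    then have "Q r' j + Q i s - Q i j \<in> exchange_values Q r' s I' J"
      using ij by (force simp: exchange_values_def)
    then show ?thesis
      using step[OF ij(2)] ij(3) by (intro bexI) (auto simp: unit_step_def)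
  next
    case False
    then have "x = Q r s" using ij assms(5) by auto
    then show ?thesis
      using step[of s] exchange_value_at_corner[of r' I' s J Q] assms by auto
  qed
next
  fix y assume "y \<in> exchange_values Q r' s I' J"
  then obtain i j where ij: "i \<in> I'" "j \<in> J" "y = Q r' j + Q i s - Q i j"
    by (rule exchange_valuesE)
  show "\<exists>x\<in>exchange_values Q r s I J. unit_step x y"
  proof (cases "i \<in> I")
    case True
    then have "Q r j + Q i s - Q i j \<in> exchange_values Q r s I J"
      using ij by (force simp: exchange_values_def)
    then show ?thesis
      using step[OF ij(2)] ij(3) by (intro bexI) (auto simp: unit_step_def)
  next
    case False
    then have "y = Q r' s" using ij assms(6) by auto
    then show ?thesis
      using step[of s] exchange_value_at_corner[of r I s J Q] assms by auto
  qed
qed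

lemma rel_set_unit_step_Max_Min:
  assumes "rel_set unit_step X Y" and "finite X" "X \<noteq> {}" "finite Y" "Y \<noteq> {}"
  shows "unit_step (Max X) (Max Y)" and "unit_step (Min X) (Min Y)"
proof -
  have up: "\<exists>y\<in>Y. unit_step x y" if "x \<in> X" for x using assms(1) that by (auto simp: rel_set_def)
  have down: "\<exists>x\<in>X. unit_step x y" if "y \<in> Y" for y using assms(1) that by (auto simp: rel_set_def)
  have "Max X \<le> Max Y"
    using up[OF Max_in] assms by (auto simp: unit_step_def Max_ge_iff)
  moreover have "Max Y \<le> Max X + 1"
  proof -
    obtain x where "x \<in> X" "Max Y \<le> x + 1"
      using down[OF Max_in] assms by (auto simp: unit_step_def)
    then show ?thesis using Max_ge[OF \<open>finite X\<close>, of x] by linarith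
  qed
  ultimately show "unit_step (Max X) (Max Y)" by (simp add: unit_step_def)
  have "Min X \<le> Min Y"
    using down[OF Min_in] assms by (auto simp: unit_step_def Min_le_iff)
  moreover have "Min Y \<le> Min X + 1"
  proof -
    obtain y where "y \<in> Y" "y \<le> Min X + 1"
      using up[OF Min_in] assms by (auto simp: unit_step_def)
    then show ?thesis using Min_le[OF \<open>finite Y\<close>, of y] by linarith
  qed
  ultimately show "unit_step (Min X) (Min Y)" by (simp add: unit_step_def)
qed

section \<open>Directional transformations as extremal exchange values\<close>

text \<open>The rows that the corner opposite to \<open>(r, s)\<close> of a rectangle in direction \<open>d\<close> may have. Towards
  the north they start at \<open>1\<close>, like the rectangles in the definition of the defect; by monotonicity
  a rectangle reaching row \<open>0\<close> has nonnegative volume and would not change the minimum.\<close>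

fun opposite_rows :: "nat \<Rightarrow> direction \<Rightarrow> nat \<Rightarrow> nat set" where
  "opposite_rows n SE r = {r<..n}"
| "opposite_rows n SW r = {r<..n}"
| "opposite_rows n NW r = {1..r}"
| "opposite_rows n NE r = {1..r}"

fun opposite_cols :: "nat \<Rightarrow> direction \<Rightarrow> nat \<Rightarrow> nat set" where
  "opposite_cols n SE s = {s<..n}"
| "opposite_cols n SW s = {1..s}"
| "opposite_cols n NW s = {1..s}"
| "opposite_cols n NE s = {s<..n}"

lemma opposite_rows_le: "r \<le> n \<Longrightarrow> i \<in> insert r (opposite_rows n d r) \<Longrightarrow> i \<le> n"
  by (cases d) auto

lemma opposite_cols_le: "s \<le> n \<Longrightarrow> j \<in> insert s (opposite_cols n d s) \<Longrightarrow> j \<le> n"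
  by (cases d) auto

lemma opposite_rows_Suc:
  "insert r (opposite_rows n d r) \<subseteq> insert r (insert (Suc r) (opposite_rows n d (Suc r)))"
  "insert (Suc r) (opposite_rows n d (Suc r)) \<subseteq> insert (Suc r) (insert r (opposite_rows n d r))"
  by (cases d; auto)+

lemma opposite_cols_Suc:
  "insert s (opposite_cols n d s) \<subseteq> insert s (insert (Suc s) (opposite_cols n d (Suc s)))"
  "insert (Suc s) (opposite_cols n d (Suc s)) \<subseteq> insert (Suc s) (insert s (opposite_cols n d s))"
  by (cases d; auto)+

definition quadrant_values ::
  "nat \<Rightarrow> direction \<Rightarrow> (nat \<Rightarrow> nat \<Rightarrow> real) \<Rightarrow> nat \<Rightarrow> nat \<Rightarrow> real set" where
  "quadrant_values n d Q r s =
     exchange_values Q r s (insert r (opposite_rows n d r)) (insert s (opposite_cols n d s))"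

lemma finite_quadrant_values: "finite (quadrant_values n d Q r s)"
  by (cases d) (auto simp: quadrant_values_def exchange_values_def)

lemma quadrant_values_nonempty: "quadrant_values n d Q r s \<noteq> {}"
  by (simp add: quadrant_values_def exchange_values_def)

lemma quadrant_values_Ints:
  assumes "\<And>a b. a \<le> n \<Longrightarrow> b \<le> n \<Longrightarrow> Q a b \<in> \<int>" and "r \<le> n" "s \<le> n"
  shows "quadrant_values n d Q r s \<subseteq> \<int>"
proof
  fix x assume "x \<in> quadrant_values n d Q r s"
  then obtain i j where "i \<in> insert r (opposite_rows n d r)" "j \<in> insert s (opposite_cols n d s)"
    and x: "x = Q r j + Q i s - Q i j"
    unfolding quadrant_values_def by (rule exchange_valuesE)
  then have "i \<le> n" "j \<le> n"
    using opposite_rows_le opposite_cols_le assms(2,3) by blast+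
  then show "x \<in> \<int>" unfolding x using assms by (intro Ints_add Ints_diff) auto
qed

lemma quadrant_values_steps:
  assumes "discrete_quasi_copula n Q" and "r < n" "s \<le> n"
  shows "rel_set unit_step (quadrant_values n d Q r s) (quadrant_values n d Q (Suc r) s)"
    and "rel_set unit_step (quadrant_values n d Q s r) (quadrant_values n d Q s (Suc r))"
proof -
  have "unit_step (Q r j) (Q (Suc r) j)" if "j \<in> insert s (opposite_cols n d s)" for j
    using quasi_copula_steps(1)[OF assms(1,2) opposite_cols_le[OF assms(3) that]] .
  then show "rel_set unit_step (quadrant_values n d Q r s) (quadrant_values n d Q (Suc r) s)"
    unfolding quadrant_values_def by (intro exchange_values_step opposite_rows_Suc) auto
  have "unit_step (Q i r) (Q i (Suc r))" if "i \<in> insert s (opposite_rows n d s)" for i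
    using quasi_copula_steps(2)[OF assms(1,2) opposite_rows_le[OF assms(3) that]] .
  then show "rel_set unit_step (quadrant_values n d Q s r) (quadrant_values n d Q s (Suc r))"
    unfolding quadrant_values_def exchange_values_transpose[of Q]
    by (intro exchange_values_step opposite_cols_Suc) auto
qed

lemma rectangles_eq_corner_pairs:
  assumes "r \<le> n" "s \<le> n"
  shows "rectangles n d r s = (\<lambda>(i, j). Rect (min r i) (max r i) (min s j) (max s j)) `
    (opposite_rows n d r \<times> opposite_cols n d s)"
proof -
  have shift: "(\<exists>k\<in>{c<..n}. P k) \<longleftrightarrow> (\<exists>k\<in>{1..n - c}. P (c + k))" if "c \<le> n" for c P
  proof
    assume "\<exists>k\<in>{c<..n}. P k"
    then obtain k where "k \<in> {c<..n}" "P k" by blast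
    then show "\<exists>k\<in>{1..n - c}. P (c + k)" by (intro bexI[of _ "k - c"]) auto
  next
    assume "\<exists>k\<in>{1..n - c}. P (c + k)"
    then obtain k where "k \<in> {1..n - c}" "P (c + k)" by blast
    then show "\<exists>k\<in>{c<..n}. P k" using that by (intro bexI[of _ "c + k"]) auto
  qed
  have "R \<in> rectangles n d r s \<longleftrightarrow>
      (\<exists>i\<in>opposite_rows n d r. \<exists>j\<in>opposite_cols n d s.
        R = Rect (min r i) (max r i) (min s j) (max s j))" for R
  proof (cases d)
    case SE
    show ?thesis unfolding SE rectangles.simps opposite_rows.simps opposite_cols.simps
        shift[OF assms(1)] shift[OF assms(2)] by auto
  next
    case SW
    show ?thesis unfolding SW rectangles.simps opposite_rows.simps opposite_cols.simps
        shift[OF assms(1)] by (auto simp: min_absorb2 max_absorb1)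
  next
    case NW
    show ?thesis unfolding NW rectangles.simps opposite_rows.simps opposite_cols.simps
      by (auto simp: min_absorb2 max_absorb1)
  next
    case NE
    show ?thesis unfolding NE rectangles.simps opposite_rows.simps opposite_cols.simps
        shift[OF assms(2)] by (auto simp: min_absorb2 max_absorb1)
  qed
  then show ?thesis by (auto simp: image_iff Bex_def)
qed

lemma exchange_values_insert_corner:
  "exchange_values Q r s (insert r I) (insert s J) =
    insert (Q r s) ((\<lambda>(i, j). Q r j + Q i s - Q i j) ` (I \<times> J))"
proof -
  have "insert r I \<times> insert s J = {r} \<times> insert s J \<union> insert r I \<times> {s} \<union> I \<times> J" by auto
  then show ?thesis unfolding exchange_values_def by (auto simp: image_Un)
qed

text \<open>The number \<open>0\<close> is the contribution of \<open>i = r\<close> and of \<open>j = s\<close>, where the exchange value is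
  \<open>Q r s\<close>. The sign is the one with which \<open>Q r s\<close> enters the volume.\<close>

lemma rectangle_volumes:
  assumes "r \<le> n" "s \<le> n"
  shows "insert 0 (volume Q ` rectangles n d r s) =
    (\<lambda>x. if d \<in> {SE, NW} then Q r s - x else x - Q r s) ` quadrant_values n d Q r s"
proof -
  let ?K = "opposite_rows n d r \<times> opposite_cols n d s"
  let ?sgn = "\<lambda>x. if d \<in> {SE, NW} then Q r s - x else x - Q r s"
  have "volume Q (Rect (min r i) (max r i) (min s j) (max s j)) = ?sgn (Q r j + Q i s - Q i j)"
    if "(i, j) \<in> ?K" for i j
    using that by (cases d) (auto simp: min_def max_def)
  then have "volume Q ` rectangles n d r s = (\<lambda>(i, j). ?sgn (Q r j + Q i s - Q i j)) ` ?K"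
    unfolding rectangles_eq_corner_pairs[OF assms] image_image
    by (intro image_cong refl) (auto simp only: split: prod.splits)
  then show ?thesis
    by (simp add: quadrant_values_def exchange_values_insert_corner image_image case_prod_unfold)
qed

lemma diff_Min_diff_image:
  fixes C :: "real set"
  assumes "finite C" "C \<noteq> {}"
  shows "c - Min ((\<lambda>x. c - x) ` C) = Max C"
proof -
  have "Min ((\<lambda>x. c - x) ` C) = c - Max C"
    using assms by (intro Min_eqI imageI Max_in) auto
  then show ?thesis by simp
qed

lemma add_Min_diff_image:
  fixes C :: "real set"
  assumes "finite C" "C \<noteq> {}"
  shows "c + Min ((\<lambda>x. x - c) ` C) = Min C"
proof -
  have "Min ((\<lambda>x. x - c) ` C) = Min C - c"
    using assms Min_in[OF assms] by (intro Min_eqI) auto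
  then show ?thesis by simp
qed

lemma directional_transform_eq_extremum:
  assumes "r \<le> n" "s \<le> n"
  shows "directional_transform n d Q r s =
    (if d \<in> {SE, NW} then Max (quadrant_values n d Q r s) else Min (quadrant_values n d Q r s))"
  using rectangle_volumes[OF assms, where d = d and Q = Q]
    diff_Min_diff_image[OF finite_quadrant_values[of n d Q r s] quadrant_values_nonempty, of "Q r s"]
    add_Min_diff_image[OF finite_quadrant_values[of n d Q r s] quadrant_values_nonempty, of "Q r s"]
  by (cases d) (simp_all add: defect_def)

section \<open>The transformations preserve integer valued quasi-copulas\<close>

lemma directional_transform_boundary:
  assumes "discrete_quasi_copula n Q" and "r \<le> n" "s \<le> n"
    and "r = 0 \<or> r = n \<or> s = 0 \<or> s = n"
  shows "directional_transform n d Q r s = Q r s"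
proof -
  have "volume Q R \<ge> 0" if "R \<in> rectangles n d r s" for R
    using that assms(2-4)
    by (cases d) (auto simp del: volume.simps intro!: quasi_copula_boundary_volume[OF assms(1)])
  then have "defect n d Q r s = 0"
    unfolding defect_def using finite_rectangles[of n d r s] by (intro Min_eqI) auto
  then show ?thesis by (cases d) auto
qed

lemma integral_quasi_copula_directional_transform:
  assumes "integral_quasi_copula n Q"
  shows "integral_quasi_copula n (directional_transform n d Q)"
proof -
  let ?T = "directional_transform n d Q"
  from assms have qc: "discrete_quasi_copula n Q"
    and int: "\<And>r s. r \<le> n \<Longrightarrow> s \<le> n \<Longrightarrow> Q r s \<in> \<int>"
    by (auto simp: integral_quasi_copula_def)
  have "discrete_quasi_copula n ?T"
  proof (rule quasi_copulaI)
    fix k assume "k \<le> n"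
    then show "?T k 0 = 0 \<and> ?T 0 k = 0 \<and> ?T k n = real k \<and> ?T n k = real k"
      by (simp add: directional_transform_boundary[OF qc] quasi_copula_boundary[OF qc])
  next
    fix r s assume "r < n" "s \<le> n"
    then show "unit_step (?T r s) (?T (Suc r) s)"
      using rel_set_unit_step_Max_Min[OF quadrant_values_steps(1)[OF qc, of r s d]]
      by (simp add: directional_transform_eq_extremum finite_quadrant_values
          quadrant_values_nonempty)
  next
    fix r s assume "r < n" "s \<le> n"
    then show "unit_step (?T s r) (?T s (Suc r))"
      using rel_set_unit_step_Max_Min[OF quadrant_values_steps(2)[OF qc, of r s d]]
      by (simp add: directional_transform_eq_extremum finite_quadrant_values
          quadrant_values_nonempty)
  qed
  moreover have "?T r s \<in> \<int>" if "r \<le> n" "s \<le> n" for r s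
    using subsetD[OF quadrant_values_Ints[where Q = Q, OF int that]
        Max_in[OF finite_quadrant_values quadrant_values_nonempty]]
      subsetD[OF quadrant_values_Ints[where Q = Q, OF int that]
        Min_in[OF finite_quadrant_values quadrant_values_nonempty]]
    by (simp add: directional_transform_eq_extremum[OF that])
  ultimately show ?thesis by (simp add: integral_quasi_copula_def)
qed

lemma main_transform_eq_max:
  "main_transform n Q =
     (\<lambda>r s. max (directional_transform n SE Q r s) (directional_transform n NW Q r s))"
  by (auto simp: fun_eq_iff main_transform_def main_defect_def)

lemma opposite_transform_eq_min:
  "opposite_transform n Q =
     (\<lambda>r s. min (directional_transform n SW Q r s) (directional_transform n NE Q r s))"
  by (auto simp: fun_eq_iff opposite_transform_def opposite_defect_def)

theorem theorem3p3:
  fixes n :: nat and A Q :: "nat \<Rightarrow> nat \<Rightarrow> real"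
  assumes "n \<ge> 1"
    and "proper_asm n A"
    and "Q = quasi_copula_of A"
  shows "\<forall>Q' \<in> {directional_transform n SE Q, directional_transform n SW Q,
                directional_transform n NW Q, directional_transform n NE Q,
                main_transform n Q, opposite_transform n Q}.
           discrete_quasi_copula n Q' \<and> asm n (abm_of Q')"
proof
  fix Q' assume Q': "Q' \<in> {directional_transform n SE Q, directional_transform n SW Q,
                directional_transform n NW Q, directional_transform n NE Q,
                main_transform n Q, opposite_transform n Q}"
  have "integral_quasi_copula n Q"
    using assms integral_quasi_copula_of_asm by (simp add: proper_asm_def)
  note T = integral_quasi_copula_directional_transform[OF this]
  have "integral_quasi_copula n Q'"
    using Q' T integral_quasi_copula_max[OF T T, of SE NW] integral_quasi_copula_min[OF T T, of SW NE]
    by (auto simp only: main_transform_eq_max opposite_transform_eq_min)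
  then show "discrete_quasi_copula n Q' \<and> asm n (abm_of Q')"
    using asm_abm_of by (simp add: integral_quasi_copula_def)
qed

end
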